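(* Let $s$ be an integer greater than $27$, and set \[A_s^{(2)}:=\{r\in\mathbb{Z}\setminus\{0\}\mid s/r\text{ is a }2\text{-step relation number}\}.\] Then \[\underline{d}\left(A_s^{(2)}\right)\ \ge\ 1-\left(1-\frac{11}{s}\right)\prod_{n=1}^{\infty}\left(1-\frac{4}{s^{2^n-1}}\right).\]
   Context: For $q\in\mathbb{C}$ let $a=\begin{pmatrix}1&0\\1&1\end{pmatrix}$ and $b_q=\begin{pmatrix}1&q\\0&1\end{pmatrix}$. For an integer $\ell\ge 0$, $q\in\mathbb{C}$ is an $\ell$-step relation number if there exist an integer $k$ with $0\le k\le \ell$ and nonzero integers $m_1,\dots,m_{2k+1}$ such that the matrix $b_q^{m_1}a^{m_2}b_q^{m_3}a^{m_4}\cdots a^{m_{2k}}b_q^{m_{2k+1}}$ is lower-triangular. For $X\subseteq\mathbb{Z}$, the lower density is $\underline{d}(X)=\liminf_{N\to\infty}\#(X\cap[1,N])/N$. *)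

theory Defs
  imports "HOL-Analysis.Analysis"
begin

text \<open>
  Square matrices of the type below carry no multiplicative power operation, because
  \<open>(*)\<close> on vectors is componentwise; powers are with respect to \<open>(**)\<close>.
\<close>

definition mat_pow_nat :: "complex^2^2 \<Rightarrow> nat \<Rightarrow> complex^2^2" where
  "mat_pow_nat A n = (((**) A) ^^ n) (mat 1)"

definition mat_pow_int :: "complex^2^2 \<Rightarrow> int \<Rightarrow> complex^2^2" where
  "mat_pow_int A m =
     (if 0 \<le> m then mat_pow_nat A (nat m) else mat_pow_nat (matrix_inv A) (nat (- m)))"

definition mat_a :: "complex^2^2" where
  "mat_a = vector [vector [1, 0], vector [1, 1]]"

definition mat_b :: "complex \<Rightarrow> complex^2^2" where
  "mat_b q = vector [vector [1, q], vector [0, 1]]"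

text \<open>
  \<open>relation_word q k m\<close> is
  \<open>b\<^sub>q^(m 1) a^(m 2) b\<^sub>q^(m 3) \<dots> a^(m (2k)) b\<^sub>q^(m (2k+1))\<close>.
\<close>

primrec relation_word :: "complex \<Rightarrow> nat \<Rightarrow> (nat \<Rightarrow> int) \<Rightarrow> complex^2^2" where
  "relation_word q 0 m = mat_pow_int (mat_b q) (m 1)"
| "relation_word q (Suc k) m =
     relation_word q k m ** mat_pow_int mat_a (m (2 * k + 2)) ** mat_pow_int (mat_b q) (m (2 * k + 3))"

text \<open>
  Stated with explicit indices: in the index type \<open>2\<close> the element \<open>2\<close> equals \<open>0\<close>
  and hence precedes \<open>1\<close> in the type's order.
\<close>

definition lower_triangular2 :: "complex^2^2 \<Rightarrow> bool" where
  "lower_triangular2 A \<longleftrightarrow> A $ 1 $ 2 = 0"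

definition step_relation_number :: "nat \<Rightarrow> complex \<Rightarrow> bool" where
  "step_relation_number l q \<longleftrightarrow>
     (\<exists>k\<le>l. \<exists>m :: nat \<Rightarrow> int.
        (\<forall>i\<in>{1..2 * k + 1}. m i \<noteq> 0) \<and> lower_triangular2 (relation_word q k m))"

definition lower_density :: "int set \<Rightarrow> ereal" where
  "lower_density X = liminf (\<lambda>N::nat. ereal (real (card (X \<inter> {1..int N})) / real N))"

definition relation_denominators :: "nat \<Rightarrow> int \<Rightarrow> int set" where
  "relation_denominators l s = {r. r \<noteq> 0 \<and> step_relation_number l (of_int s / of_int r)}"

end

theory Submission
  imports Defs "HOL-Number_Theory.Totient"
begin

text \<open>
  In fact the density is 1, already for 1-step relation numbers: every nonzero \<open>r\<close> with a
  divisor \<open>t \<noteq> 1\<close>, \<open>t \<equiv> 1\<close> modulo \<open>s\<close>, is a denominator. Almost every \<open>r\<close> has such a divisor.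
  Since \<open>\<phi>(n!)/n!\<close> tends to 0 with \<open>n\<close>, there are \<open>s\<close> pairwise coprime numbers \<open>M\<^sub>i\<close>, coprime to \<open>s\<close>, with
  \<open>\<phi>(M\<^sub>i)/M\<^sub>i\<close> as small as desired, so all \<open>r\<close> outside a set of small density share a factor
  \<open>d\<^sub>i > 1\<close> with each \<open>M\<^sub>i\<close>. By the pigeonhole principle two of the \<open>s + 1\<close> partial products
  \<open>d\<^sub>0 \<cdots> d\<^sub>j\<^sub>-\<^sub>1\<close> agree modulo \<open>s\<close>; their quotient is a divisor of \<open>r\<close> congruent to 1.
\<close>

section \<open>Powers of \<open>mat_b\<close> and 1-step words\<close>

lemma mat_b_mult: "mat_b x ** mat_b y = mat_b (x + y)"
  by (simp add: vec_eq_iff forall_2 matrix_matrix_mult_def sum_2 mat_b_def)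

lemma mat_b_0: "mat_b 0 = mat 1"
  by (simp add: vec_eq_iff forall_2 mat_def mat_b_def)

lemma mat_b_pow_nat: "mat_pow_nat (mat_b q) n = mat_b (of_nat n * q)"
  by (induction n) (simp_all add: mat_pow_nat_def mat_b_0 mat_b_mult algebra_simps)

text \<open>\<open>matrix_inv\<close> is only a choice of a two-sided inverse; uniqueness of
  inverses identifies it.\<close>

lemma mat_b_inv: "matrix_inv (mat_b q) = mat_b (- q)"
proof -
  have b: "mat_b q ** mat_b (- q) = mat 1" "mat_b (- q) ** mat_b q = mat 1"
    by (simp_all add: mat_b_mult mat_b_0)
  then have "\<exists>B. mat_b q ** B = mat 1 \<and> B ** mat_b q = mat 1"
    by blast
  then have "matrix_inv (mat_b q) ** mat_b q = mat 1"
    unfolding matrix_inv_def by (rule someI2_ex) simp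
  then show ?thesis
    by (metis b(1) matrix_mul_assoc matrix_mul_lid matrix_mul_rid)
qed

lemma mat_b_pow_int: "mat_pow_int (mat_b q) m = mat_b (of_int m * q)"
  by (auto simp: mat_pow_int_def mat_b_pow_nat mat_b_inv)

lemma mat_a_pow_1: "mat_pow_int mat_a 1 = mat_a"
  by (simp add: mat_pow_int_def mat_pow_nat_def)

text \<open>The word \<open>b_q^m a b_q^n\<close> has upper right entry \<open>x + y + x * y\<close>
  with \<open>x = m * q\<close> and \<open>y = n * q\<close>, which is the expression assumed to
  vanish.\<close>

lemma step_relation_numberI:
  assumes "m \<noteq> 0" "n \<noteq> 0" "1 \<le> l" and "(of_int m + of_int n + of_int m * of_int n * q) * q = 0"
  shows "step_relation_number l q"
proof -
  define f :: "nat \<Rightarrow> int" where "f = (\<lambda>i. if i = 1 then m else if i = 2 then 1 else n)"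
  have "relation_word q 1 f = mat_b (of_int m * q) ** mat_a ** mat_b (of_int n * q)"
    by (simp add: f_def mat_b_pow_int mat_a_pow_1)
  moreover have "(mat_b x ** mat_a ** mat_b y) $ 1 $ 2 = x + y + x * y" for x y
    by (simp add: matrix_matrix_mult_def sum_2 mat_a_def mat_b_def algebra_simps)
  ultimately have "lower_triangular2 (relation_word q 1 f)"
    using assms by (simp add: lower_triangular2_def algebra_simps)
  moreover have "\<forall>i\<in>{1..2 * 1 + 1}. f i \<noteq> 0"
    using assms by (simp add: f_def)
  ultimately show ?thesis
    unfolding step_relation_number_def using \<open>1 \<le> l\<close> by blast
qed

lemma mem_relation_denominators:
  assumes "r \<noteq> 0" "t dvd r" "[t = 1] (mod s)" "t \<noteq> 1" "1 \<le> l"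
  shows "r \<in> relation_denominators l s"
proof -
  txt \<open>With \<open>r = t x\<close>, \<open>t = 1 + s k\<close> and \<open>q = s / r\<close>, the word is \<open>b\<^sub>q^(-x k) a b\<^sub>q^(r k)\<close>.\<close>
  obtain x where x: "r = t * x" using assms by blast
  obtain k where k: "t = 1 + s * k"
    using assms(3) by (metis add.commute cong_iff_lin cong_sym)
  have nz: "x * k \<noteq> 0" "r * k \<noteq> 0" using assms x k by auto
  have "(of_int (-(x*k)) + of_int (r*k) + of_int (-(x*k)) * of_int (r*k) * (of_int s / of_int r)) =
      (of_int (- (x*k) + r * k - x * k * k * s) :: complex)"
    using \<open>r \<noteq> 0\<close> by (simp add: field_simps)
  also have "- (x*k) + r * k - x * k * k * s = 0"
    unfolding x k by (simp add: algebra_simps)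
  finally have "step_relation_number l (of_int s / of_int r)"
    using nz assms by (intro step_relation_numberI[of "-(x*k)" "r*k"]) auto
  then show ?thesis using assms by (simp add: relation_denominators_def)
qed

section \<open>Subproducts congruent to 1\<close>

text \<open>Two of the \<open>s + 1\<close> partial products \<open>P 0\<close>, ...,
  \<open>P s\<close> agree modulo \<open>s\<close>. The shorter one is coprime to \<open>s\<close>
  and cancels, so \<open>I\<close> can be the interval of indices between them.\<close>

lemma exists_subproduct_cong_1:
  fixes d :: "nat \<Rightarrow> nat"
  assumes "s > 0" and cop: "\<And>i. i < s \<Longrightarrow> coprime (d i) s"
  shows "\<exists>I. I \<subseteq> {..<s} \<and> I \<noteq> {} \<and> [(\<Prod>i\<in>I. d i) = 1] (mod s)"
proof -
  define P where "P j = (\<Prod>i<j. d i)" for j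
  have "(\<lambda>j. P j mod s) ` {..s} \<subseteq> {..<s}"
    using \<open>s > 0\<close> by auto
  then have "card ((\<lambda>j. P j mod s) ` {..s}) \<le> s"
    using card_mono[of "{..<s}"] by (metis card_lessThan finite_lessThan)
  then have "\<not> inj_on (\<lambda>j. P j mod s) {..s}"
    using card_image[of "\<lambda>j. P j mod s" "{..s}"] by auto
  then obtain i j where ij: "i < j" "j \<le> s" "P i mod s = P j mod s"
    by (metis (mono_tags, lifting) atMost_iff inj_onI linorder_neqE_nat)
  have "P j = P i * prod d {i..<j}"
    unfolding P_def using ij prod.atLeastLessThan_concat[of 0 i j d]
    by (simp add: lessThan_atLeast0)
  then have "[P i * prod d {i..<j} = P i * 1] (mod s)"
    using ij by (simp add: cong_def)
  moreover have "coprime (P i) s"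
    unfolding P_def using cop ij by (intro prod_coprime_left) auto
  ultimately have "[prod d {i..<j} = 1] (mod s)"
    using cong_mult_lcancel_nat by blast
  then show ?thesis
    using ij by (intro exI[of _ "{i..<j}"]) auto
qed

section \<open>Numbers with small totient ratio\<close>

lemma prod_antimono_subset:
  fixes f :: "'a \<Rightarrow> real"
  assumes "finite B" "A \<subseteq> B" "\<And>x. x \<in> B \<Longrightarrow> 0 \<le> f x \<and> f x \<le> 1"
  shows "prod f B \<le> prod f A"
proof -
  have "prod f B = prod f (B - A) * prod f A"
    using assms by (intro prod.subset_diff)
  also have "\<dots> \<le> 1 * prod f A"
    using assms by (intro mult_right_mono prod_le_1 prod_nonneg) auto
  finally show ?thesis by simp
qed

text \<open>Every prime factor of \<open>b\<close> divides \<open>a * b\<close>, so the Euler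
  product of \<open>a * b\<close> only gains factors, each at most 1.\<close>

lemma totient_mult_le: "totient (a * b) \<le> a * totient b"
proof (cases "a = 0 \<or> b = 0")
  case False
  have "(\<Prod>p\<in>prime_factors (a * b). 1 - 1 / real p) \<le> (\<Prod>p\<in>prime_factors b. 1 - 1 / real p)"
    using False
    by (intro prod_antimono_subset)
      (auto simp: in_prime_factors_iff Suc_le_eq dest: prime_gt_0_nat)
  then have "real (totient (a * b)) \<le> real a * real b * (\<Prod>p\<in>prime_factors b. 1 - 1 / real p)"
    unfolding totient_formula2 by (simp add: mult_left_mono)
  also have "\<dots> = real (a * totient b)"
    by (simp add: totient_formula2)
  finally show ?thesis by linarith
qed auto

text \<open>Each divisor \<open>d\<close> satisfies \<open>totient n / d\<close> \<le>
  \<open>totient (n div d)\<close>, and the right-hand sides sum to \<open>n\<close>.\<close>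

lemma totient_sum_inverse_divisors_le:
  assumes "n > 0"
  shows "real (totient n) * (\<Sum>d | d dvd n. 1 / real d) \<le> real n"
proof -
  have "real (totient n) * (\<Sum>d | d dvd n. 1 / real d) = (\<Sum>d | d dvd n. real (totient n) / real d)"
    by (simp add: sum_distrib_left)
  also have "\<dots> \<le> (\<Sum>d | d dvd n. real (totient (n div d)))"
  proof (rule sum_mono)
    fix d assume "d \<in> {d. d dvd n}"
    then obtain e where e: "n = d * e" by blast
    have "real (totient n) \<le> real d * real (totient e)"
      using totient_mult_le[of d e] e by (metis of_nat_le_iff of_nat_mult)
    then show "real (totient n) / real d \<le> real (totient (n div d))"
      using assms e by (simp add: field_simps)
  qed
  also have "\<dots> = (\<Sum>d | d dvd n. real (totient d))"
    using assms by (intro sum.reindex_bij_witness[of _ "(div) n" "(div) n"]) (auto elim: dvdE)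
  also have "\<dots> = real n"
    by (metis of_nat_sum totient_divisor_sum)
  finally show ?thesis .
qed

text \<open>All \<open>d\<close> \<le> \<open>k\<close> divide \<open>fact k\<close>, so the
  preceding bound gives a totient ratio of at most \<open>1 / harm k\<close>, and the harmonic
  series diverges.\<close>

lemma exists_small_totient:
  assumes "\<epsilon> > 0"
  shows "\<exists>n>0. real (totient n) < \<epsilon> * real n"
proof -
  have "filterlim (\<lambda>n. harm n :: real) at_top sequentially"
    by (rule harm_at_top)
  then have "eventually (\<lambda>n. harm n > 1 / \<epsilon>) sequentially"
    by (simp add: filterlim_at_top_dense)
  then obtain k where k: "harm k > 1 / \<epsilon>"
    using eventually_happens by fastforce
  have "harm k = (\<Sum>d\<in>{1..k}. 1 / real d)"
    by (simp add: harm_def field_simps)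
  also have "\<dots> \<le> (\<Sum>d | d dvd fact k. 1 / real d)"
    by (intro sum_mono2) (auto simp: dvd_fact)
  finally have "real (totient (fact k)) * harm k \<le> real (totient (fact k)) * (\<Sum>d | d dvd fact k. 1 / real d)"
    by (intro mult_left_mono) auto
  also have "\<dots> \<le> real (fact k)"
    by (rule totient_sum_inverse_divisors_le) simp
  finally have "real (totient (fact k)) * harm k \<le> real (fact k)" .
  moreover have "real (totient (fact k)) * (1 / \<epsilon>) < real (totient (fact k)) * harm k"
    using k by (intro mult_strict_left_mono) auto
  ultimately have "real (totient (fact k)) * (1 / \<epsilon>) < real (fact k)"
    by linarith
  then have "real (totient (fact k)) < \<epsilon> * real (fact k)"
    using \<open>\<epsilon> > 0\<close> by (simp add: field_simps)
  then show ?thesis by (intro exI[of _ "fact k"]) simp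
qed

text \<open>Dropping the primes of \<open>m\<close> from \<open>n\<close> raises the totient ratio
  by a factor of at most \<open>1 / c\<close>, where \<open>c\<close> depends on \<open>m\<close>
  only. Hence \<open>n\<close> is chosen with ratio below \<open>\<epsilon> * c\<close>, and
  \<open>M\<close> is the product of the primes that remain.\<close>

lemma exists_coprime_small_totient:
  assumes "\<epsilon> > 0" "m > 0"
  shows "\<exists>M>0. coprime M m \<and> real (totient M) < \<epsilon> * real M"
proof -
  define f where "f p = 1 - 1 / real p" for p :: nat
  have f: "0 < f p" "f p \<le> 1" if "prime p" for p
    using prime_gt_1_nat[OF that] by (auto simp: f_def)
  define c where "c = prod f (prime_factors m)"
  have "c > 0" unfolding c_def using f by (intro prod_pos) auto
  then obtain n where n: "n > 0" "real (totient n) < (\<epsilon> * c) * real n"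
    using exists_small_totient \<open>\<epsilon> > 0\<close> by (meson mult_pos_pos)
  define P where "P = prime_factors n - prime_factors m"
  define M where "M = \<Prod>P"
  have [simp]: "finite P" and pP: "\<And>p. p \<in> P \<Longrightarrow> prime p" by (auto simp: P_def)
  have "M > 0" unfolding M_def using pP by (auto intro!: prod_pos prime_gt_0_nat)
  moreover have "coprime M m" unfolding M_def
    using \<open>m > 0\<close> by (intro prod_coprime_left) (auto simp: P_def in_prime_factors_iff prime_imp_coprime)
  moreover have "real (totient M) < \<epsilon> * real M"
  proof -
    have "totient M = (\<Prod>p\<in>P. totient p)"
      unfolding M_def using totient_prod_coprime[of "\<lambda>p. p" P] pP
      by (auto simp: pairwise_def primes_coprime)
    then have M: "real (totient M) = real M * prod f P"
      using pP prime_gt_0_nat unfolding M_def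
      by (auto simp: totient_prime f_def of_nat_diff prime_ge_Suc_0_nat divide_simps
          simp flip: prod.distrib intro!: prod.cong)
    \<comment> \<open>The intersection lies in \<open>prime_factors m\<close>, so its product is at
      least \<open>c\<close>.\<close>
    have "c * prod f P \<le> prod f (prime_factors n \<inter> prime_factors m) * prod f P"
      unfolding c_def using f pP
      by (intro mult_right_mono prod_antimono_subset prod_nonneg) (auto intro: less_imp_le)
    also have "\<dots> = prod f (prime_factors n)"
      unfolding P_def by (subst prod.union_disjoint[symmetric]) (auto intro!: prod.cong)
    also have "\<dots> < \<epsilon> * c"
      using n by (simp add: totient_formula2 f_def mult.commute)
    finally have "prod f P < \<epsilon>" using \<open>c > 0\<close> by (simp add: mult.commute)
    then show ?thesis using M \<open>M > 0\<close> by simp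
  qed
  ultimately show ?thesis by blast
qed

text \<open>Each new block is chosen coprime to \<open>s\<close> times the product of all earlier
  blocks.\<close>

lemma exists_coprime_blocks:
  fixes s :: nat
  assumes "\<epsilon> > 0" "s > 0"
  shows "\<exists>M :: nat \<Rightarrow> nat. (\<forall>i<k. M i > 0 \<and> coprime (M i) s \<and> real (totient (M i)) < \<epsilon> * real (M i))
     \<and> (\<forall>i<k. \<forall>j<i. coprime (M i) (M j))"
proof (induction k)
  case (Suc k)
  then obtain M where M: "\<And>i. i < k \<Longrightarrow> M i > 0 \<and> coprime (M i) s \<and> real (totient (M i)) < \<epsilon> * real (M i)"
     "\<And>i j. i < k \<Longrightarrow> j < i \<Longrightarrow> coprime (M i) (M j)" by blast
  have "s * (\<Prod>i<k. M i) > 0" using M \<open>s > 0\<close> by (auto intro!: prod_pos)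
  then obtain L where L: "L > 0" "coprime L (s * (\<Prod>i<k. M i))" "real (totient L) < \<epsilon> * real L"
    using exists_coprime_small_totient \<open>\<epsilon> > 0\<close> by blast
  have "coprime L (M j)" if "j < k" for j
    using L(2) that by (meson coprime_divisors coprime_mult_right_iff dvd_prodI dvd_refl finite_lessThan lessThan_iff)
  then show ?case using M L
    by (intro exI[of _ "M(k := L)"]) (auto simp: less_Suc_eq)
qed auto

section \<open>Counting exceptions and lower density\<close>

text \<open>Coprimality to \<open>M\<close> depends only on the residue, so such an \<open>n\<close>
  is given by a quotient \<open>j\<close> \<le> \<open>N div M\<close> and a totative
  \<open>r\<close>.\<close>

lemma card_coprime_le:
  assumes "M > 0"
  shows "card {n \<in> {1..N}. coprime n M} \<le> (N div M + 1) * totient M"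
proof -
  have "{n \<in> {1..N}. coprime n M} \<subseteq> (\<lambda>(j, r). r + j * M) ` ({..N div M} \<times> totatives M)"
  proof
    fix n assume n: "n \<in> {n \<in> {1..N}. coprime n M}"
    \<comment> \<open>The shift by one makes \<open>r\<close> range over 1, ..., \<open>M\<close>,
      where \<open>totatives M\<close> lives.\<close>
    define j r where "j = (n - 1) div M" and "r = Suc ((n - 1) mod M)"
    have eq: "n = r + j * M"
      using n div_mult_mod_eq[of "n - 1" M] unfolding j_def r_def by auto
    have "j \<le> N div M" unfolding j_def using n by (auto intro!: div_le_mono)
    moreover have "coprime r M"
    proof -
      have "gcd M n = gcd M r"
        unfolding eq by (metis add.commute gcd_add_mult)
      then show ?thesis
        using n by (simp add: coprime_iff_gcd_eq_1 gcd.commute[of _ M])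
    qed
    then have "r \<in> totatives M"
      using assms by (simp add: in_totatives_iff r_def Suc_le_eq)
    ultimately show "n \<in> (\<lambda>(j, r). r + j * M) ` ({..N div M} \<times> totatives M)"
      using eq by force
  qed
  then have "card {n \<in> {1..N}. coprime n M} \<le> card ({..N div M} \<times> totatives M)"
    by (intro surj_card_le) auto
  then show ?thesis by (simp add: card_cartesian_product totient_def)
qed

lemma lower_density_ge_1I:
  assumes "\<And>\<delta>::real. \<delta> > 0 \<Longrightarrow> \<exists>C. \<forall>N. real N - real (card (X \<inter> {1..int N})) \<le> \<delta> * real N + C"
  shows "lower_density X \<ge> 1"
proof -
  have "ereal (1 - \<epsilon>) \<le> lower_density X" if "\<epsilon> > 0" for \<epsilon>
  proof -
    obtain C where C: "\<And>N. real N - real (card (X \<inter> {1..int N})) \<le> (\<epsilon>/2) * real N + C"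
      using assms[of "\<epsilon>/2"] \<open>\<epsilon> > 0\<close> by auto
    \<comment> \<open>Half of \<open>\<epsilon>\<close> is kept to absorb the constant
      \<open>C\<close>; the 0 in \<open>max\<close> makes the division by \<open>N\<close>
      legitimate.\<close>
    have "eventually (\<lambda>N. real N > max 0 (2 * C / \<epsilon>)) sequentially"
      using filterlim_real_sequentially filterlim_at_top_dense by blast
    then have "eventually (\<lambda>N. ereal (1 - \<epsilon>) \<le> ereal (real (card (X \<inter> {1..int N})) / real N)) sequentially"
    proof eventually_elim
      case (elim N)
      then have "C \<le> \<epsilon> / 2 * real N" using \<open>\<epsilon> > 0\<close> by (simp add: field_simps)
      then have "(1 - \<epsilon>) * real N \<le> real (card (X \<inter> {1..int N}))"
        using C[of N] by (simp add: algebra_simps)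
      then show ?case using elim by (simp add: field_simps)
    qed
    then show ?thesis unfolding lower_density_def by (rule Liminf_bounded)
  qed
  then have "1 \<le> lower_density X + ereal \<epsilon>" if "\<epsilon> > 0" for \<epsilon>
    using that by (metis ereal_minus_le_iff ereal_minus(1) one_ereal_def PInfty_neq_ereal(1) abs_ereal.simps(1))
  then show ?thesis using ereal_le_epsilon2 by blast
qed

text \<open>The numbers \<open>gcd n (M i)\<close> exceed 1, are pairwise coprime and are coprime to
  \<open>s\<close>. A subproduct congruent to 1 modulo \<open>s\<close> therefore divides
  \<open>n\<close>, and it is not 1 because \<open>I\<close> is nonempty.\<close>

lemma relation_denominators_of_blocks:
  fixes M :: "nat \<Rightarrow> nat"
  assumes "s > 0" "n > 0" "1 \<le> l"
    and s: "\<And>i. i < s \<Longrightarrow> coprime (M i) s"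
    and pc: "\<And>i j. i < s \<Longrightarrow> j < i \<Longrightarrow> coprime (M i) (M j)"
    and n: "\<And>i. i < s \<Longrightarrow> \<not> coprime n (M i)"
  shows "int n \<in> relation_denominators l (int s)"
proof -
  define d where "d i = gcd n (M i)" for i
  obtain I where I: "I \<subseteq> {..<s}" "I \<noteq> {}" "[prod d I = 1] (mod s)"
    using exists_subproduct_cong_1[of s d] \<open>s > 0\<close> s
    by (metis coprime_divisors d_def dvd_refl gcd_dvd2)
  have "finite I" using I(1) finite_subset by blast
  have "coprime (d i) (d j)" if "i \<in> I" "j \<in> I" "i \<noteq> j" for i j
  proof -
    have "coprime (M i) (M j)"
      using that I(1) pc by (metis coprime_commute lessThan_iff linorder_neqE_nat subsetD)
    then show ?thesis unfolding d_def by (meson coprime_divisors gcd_dvd2)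
  qed
  then have "prod d I dvd n"
    using \<open>finite I\<close>
  proof (induction rule: finite_induct[OF \<open>finite I\<close>])
    case (2 i J)
    then show ?case
      by (auto intro!: divides_mult prod_coprime_right simp: d_def)
  qed simp
  moreover obtain i where i: "i \<in> I" using I by blast
  have "d i \<noteq> 1" using n I i by (auto simp: d_def coprime_iff_gcd_eq_1)
  then have "prod d I \<noteq> 1"
    using \<open>finite I\<close> i by (metis dvd_prodI nat_dvd_1_iff_1)
  moreover have "[int (prod d I) = 1] (mod int s)"
    using I(3) cong_int_iff[of "prod d I" 1 s] by simp
  ultimately show ?thesis
    using \<open>n > 0\<close> \<open>1 \<le> l\<close> mem_relation_denominators[of "int n" "int (prod d I)" "int s" l]
    by (metis of_nat_0_eq_iff of_nat_1_eq_iff of_nat_dvd_iff less_numeral_extra(3))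
qed

lemma lower_density_relation_denominators:
  assumes "s > 0" "1 \<le> l"
  shows "lower_density (relation_denominators l (int s)) \<ge> 1"
proof (rule lower_density_ge_1I)
  fix \<delta> :: real assume "\<delta> > 0"
  \<comment> \<open>An exception is coprime to one of \<open>s\<close> blocks, so each block may
    contribute a share \<open>\<delta> / s\<close>.\<close>
  define \<epsilon> where "\<epsilon> = \<delta> / real s"
  have "\<epsilon> > 0" using \<open>\<delta> > 0\<close> assms by (simp add: \<epsilon>_def)
  obtain M where M: "\<And>i. i < s \<Longrightarrow> M i > 0" "\<And>i. i < s \<Longrightarrow> coprime (M i) s"
      "\<And>i. i < s \<Longrightarrow> real (totient (M i)) < \<epsilon> * real (M i)"
      "\<And>i j. i < s \<Longrightarrow> j < i \<Longrightarrow> coprime (M i) (M j)"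
    using exists_coprime_blocks[OF \<open>\<epsilon> > 0\<close> \<open>s > 0\<close>, of s] by blast
  let ?X = "relation_denominators l (int s)"
  have "real N - real (card (?X \<inter> {1..int N})) \<le> \<delta> * real N + real (\<Sum>i<s. totient (M i))" for N
  proof -
    let ?B = "\<lambda>i. {n \<in> {1..N}. coprime n (M i)}"
    have "{1..int N} - ?X \<subseteq> int ` (\<Union>i<s. ?B i)"
    proof
      fix r assume r: "r \<in> {1..int N} - ?X"
      then obtain n where n: "r = int n" "n > 0" "n \<le> N"
        by (metis Diff_iff atLeastAtMost_iff int_one_le_iff_zero_less of_nat_le_iff zero_less_imp_eq_int)
      then have "\<exists>i<s. coprime n (M i)"
        using relation_denominators_of_blocks[OF \<open>s > 0\<close> \<open>n > 0\<close> \<open>1 \<le> l\<close>, of M] M r by blast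
      then have "n \<in> (\<Union>i<s. ?B i)" using n by auto
      then show "r \<in> int ` (\<Union>i<s. ?B i)" unfolding n(1) by (rule imageI)
    qed
    then have "card ({1..int N} - ?X) \<le> card (\<Union>i<s. ?B i)"
      by (intro surj_card_le) auto
    also have "\<dots> \<le> (\<Sum>i<s. card (?B i))"
      by (intro card_UN_le) auto
    finally have "real (card ({1..int N} - ?X)) \<le> (\<Sum>i<s. real (card (?B i)))"
      by (metis (no_types, lifting) of_nat_le_iff of_nat_sum sum.cong)
    also have "\<dots> \<le> (\<Sum>i<s. \<epsilon> * real N + real (totient (M i)))"
    proof (rule sum_mono)
      fix i assume "i \<in> {..<s}"
      then have i: "i < s" by simp
      have "real (card (?B i)) \<le> real (N div M i) * real (totient (M i)) + real (totient (M i))"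
        using of_nat_mono[OF card_coprime_le[OF M(1)[OF i], of N], where ?'a = real]
        by (simp add: algebra_simps)
      moreover have "real (N div M i) * real (totient (M i)) \<le> (real N / real (M i)) * (\<epsilon> * real (M i))"
        using M(3)[OF i] by (intro mult_mono of_nat_div_le_of_nat) auto
      ultimately show "real (card (?B i)) \<le> \<epsilon> * real N + real (totient (M i))"
        using M(1)[OF i] by (simp add: mult.commute)
    qed
    also have "\<dots> = \<delta> * real N + real (\<Sum>i<s. totient (M i))"
      using assms by (simp add: sum.distrib \<epsilon>_def)
    finally have "real (card ({1..int N} - ?X)) \<le> \<delta> * real N + real (\<Sum>i<s. totient (M i))" .
    moreover have "N = card ({1..int N} - ?X) + card (?X \<inter> {1..int N})"
      using card_Int_Diff[of "{1..int N}" ?X] by (simp add: Int_commute)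
    ultimately show ?thesis by linarith
  qed
  then show "\<exists>C. \<forall>N. real N - real (card (?X \<inter> {1..int N})) \<le> \<delta> * real N + C" by blast
qed

section \<open>Comparison with the infinite product\<close>

text \<open>Nonnegative factors give a nonnegative value once the product is known to converge;
  convergence follows by comparison with a geometric series of ratio \<open>1 / s\<close>.\<close>

lemma prodinf_one_minus_powers_nonneg:
  fixes s :: real
  assumes "s \<ge> 4"
  shows "(\<Prod>n. 1 - 4 / s ^ (2 ^ Suc n - 1)) \<ge> 0"
proof -
  have le: "norm (1 - 4 / s ^ (2 ^ Suc n - 1) - 1) \<le> 4 * (1 / s) ^ Suc n" for n
  proof -
    have "Suc n \<le> 2 ^ Suc n - 1"
      using less_exp[of "Suc n"] by linarith
    then have "s ^ Suc n \<le> s ^ (2 ^ Suc n - 1)"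
      using assms by (intro power_increasing) auto
    then show ?thesis
      using assms by (simp add: power_one_over frac_le del: power_Suc)
  qed
  have "summable (\<lambda>n. 4 * (1 / s) ^ Suc n)"
    using assms by (intro summable_mult summable_geometric[THEN summable_ignore_initial_segment[where k=1], simplified]) auto
  then have "summable (\<lambda>n. norm (1 - 4 / s ^ (2 ^ Suc n - 1) - 1))"
    by (rule summable_comparison_test') (use le in simp)
  then have "(\<lambda>n. 1 - 4 / s ^ (2 ^ Suc n - 1)) has_prod (\<Prod>n. 1 - 4 / s ^ (2 ^ Suc n - 1))"
    by (intro convergent_prod_has_prod abs_convergent_prod_imp_convergent_prod summable_imp_abs_convergent_prod)
  then show ?thesis
  proof (rule has_prod_nonneg)
    fix n
    have "(1::nat) \<le> 2 ^ Suc n - 1"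
      using less_exp[of "Suc n"] by linarith
    then have "s ^ 1 \<le> s ^ (2 ^ Suc n - 1)"
      using assms by (intro power_increasing) auto
    then show "0 \<le> 1 - 4 / s ^ (2 ^ Suc n - 1)"
      using assms by simp
  qed
qed

theorem theorem1p5:
  fixes s :: int
  assumes "s > 27"
  shows "lower_density (relation_denominators 2 s)
    \<ge> ereal (1 - (1 - 11 / real_of_int s)
        * (\<Prod>n. 1 - 4 / real_of_int s ^ (2 ^ Suc n - 1)))"
proof -
  \<comment> \<open>Both \<open>1 - 11 / s\<close> and the infinite product are nonnegative, so the
    claimed bound is at most 1.\<close>
  have "ereal (1 - (1 - 11 / real_of_int s)
        * (\<Prod>n. 1 - 4 / real_of_int s ^ (2 ^ Suc n - 1))) \<le> 1"
    using assms prodinf_one_minus_powers_nonneg[of "real_of_int s"] by (simp del: power_Suc)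
  also have "\<dots> \<le> lower_density (relation_denominators 2 s)"
    using lower_density_relation_denominators[of "nat s" 2] assms by simp
  finally show ?thesis .
qed

end
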